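(* Let $0\le m\le n$ be integers. The quantity $$\mathrm{Osc}_{m,n}^{(k)}=\sum_{Y\in\mathbb{Z}/3^n\mathbb{Z}}\left|P_{k,n}(Y)-3^{m-n}P_{k,m}(Y)\right|$$ does not depend on $k\in\mathbb{D}$; that is, $\mathrm{Osc}_{m,n}^{(k)}=\mathrm{Osc}_{m,n}^{(1)}$ for every $k\in\mathbb{D}$.
   Context: $\mathbb{D}$ denotes the set of integers $x$ with $x\equiv\pm1\pmod 6$. For $k\in\mathbb{D}$ and an odd integer $x$, the Syracuse map is $$\mathrm{Syr}_k(x)=\frac{3x+k}{2^{\nu(3x+k)}},$$ where $\nu(y)$ is the exponent of the largest power of $2$ dividing the nonzero integer $y$ (note $3x+k\neq0$ since $3\nmid k$). $\mathrm{Syr}_k(x)$ is again odd, and $\mathrm{Syr}_k^n$ denotes the $n$-fold iterate ($\mathrm{Syr}_k^0$ is the identity). For an integer $n\ge0$ and $y$ an integer (equivalently a residue class modulo $3^n$), define $$P_{k,n}(y)=\lim_{N\to\infty}\frac1N\sum_{z=1}^{N}\mathbf{1}\big(\mathrm{Syr}_k^n(2z+1)\equiv y \bmod 3^n\big),$$ where $\mathbf 1(\cdot)$ is $1$ if the condition is true and $0$ otherwise. For $m\le n$ and $Y\in\mathbb{Z}/3^n\mathbb{Z}$, $P_{k,m}(Y)$ means $P_{k,m}$ evaluated at the reduction of $Y$ modulo $3^m$. The quantity $\mathrm{Osc}_{m,n}^{(k)}$ is the oscillation (for general $k$) of the family $c_Y=P_{k,n}(Y)$. *)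

theory Defs
  imports "HOL-Analysis.Analysis" "HOL-Number_Theory.Number_Theory"
begin

definition DD :: "int set" where
  "DD = {x. [x = 1] (mod 6) \<or> [x = -1] (mod 6)}"

text \<open>Meant for odd \<open>x\<close> and \<open>k \<in> DD\<close>; then \<open>3 * x + k\<close> is nonzero,
  and the division is exact.\<close>

definition Syr :: "int \<Rightarrow> int \<Rightarrow> int" where
  "Syr k x = (3 * x + k) div 2 ^ multiplicity 2 (3 * x + k)"

text \<open>At \<open>N = 0\<close> the quotient is \<open>0 / 0 = 0\<close>, which does not affect the limit.\<close>

definition P :: "int \<Rightarrow> nat \<Rightarrow> int \<Rightarrow> real" where
  "P k n y = lim (\<lambda>N::nat. (1 / real N) *
     (\<Sum>z = 1..N. of_bool ([(Syr k ^^ n) (2 * int z + 1) = y] (mod 3 ^ n))))"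

text \<open>The ring of integers modulo \<open>3 ^ n\<close> is represented by the residues \<open>0, \<dots>, 3 ^ n - 1\<close>.\<close>

definition Osc :: "int \<Rightarrow> nat \<Rightarrow> nat \<Rightarrow> real" where
  "Osc k m n = (\<Sum>Y \<in> {0..<3 ^ n :: int}.
     \<bar>P k n Y - 3 powi (int m - int n) * P k m (Y mod 3 ^ m)\<bar>)"

end

theory Submission
  imports Defs "HOL-Real_Asymp.Real_Asymp"
begin

text \<open>
  The distribution of \<open>Syr k ^^ n\<close> modulo \<open>3 ^ n\<close> is the one of \<open>Syr 1 ^^ n\<close> multiplied
  by the unit \<open>k\<close>, that is, \<open>P k n (k * y) = P 1 n y\<close> (\<open>P_scale\<close>). Substituting
  \<open>k * Y\<close> for \<open>Y\<close>, which permutes the residues and respects the reduction from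
  \<open>3 ^ n\<close> to \<open>3 ^ m\<close>, then turns one oscillation sum into the other.

  The scaling law comes from a 2-adic comparison. On integers,
  \<open>Syr k (k * x) = k * Syr 1 x\<close>, but this alone only concerns starting points divisible by
  \<open>k\<close>. However, \<open>Syr k ^^ n\<close> at \<open>x\<close> modulo \<open>3 ^ n\<close> depends only on the exponents of
  the powers of 2 removed along the way: the contribution of \<open>x\<close> itself carries the factor
  \<open>3 ^ n\<close>. If \<open>n\<close> steps of \<open>Syr 1\<close> from \<open>x'\<close> remove at most \<open>L\<close> factors 2, these
  exponents are determined by \<open>x'\<close> modulo \<open>2 ^ (L + 1)\<close>. So \<open>x\<close> need only agree with
  \<open>k * x'\<close> modulo \<open>2 ^ (L + 1)\<close> for the iterates to be related modulo \<open>3 ^ n\<close>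
  (\<open>Syr_funpow_cong\<close>).

  Writing starting points as \<open>2 * z + 1\<close>, multiplication by \<open>k\<close> becomes an affine
  permutation of the residues of \<open>z\<close> modulo \<open>2 ^ L\<close>. Only the residues at which more than
  \<open>L\<close> factors 2 are removed escape the comparison, and there are at most \<open>(L + 1) ^ n\<close> of
  them (\<open>card_many_halvings\<close>), a vanishing proportion of \<open>2 ^ L\<close>. Hence the difference of
  the two averages that define \<open>P k n (k * y)\<close> and \<open>P 1 n y\<close> tends to 0, so that their
  limits agree (\<open>lim_eq_if_diff_tendsto_0\<close>).
\<close>

section \<open>Comparing the Syracuse maps 2-adically\<close>

primrec halvings :: "nat \<Rightarrow> int \<Rightarrow> nat" where
  "halvings 0 x = 0"
| "halvings (Suc n) x = multiplicity 2 (3 * x + 1) + halvings n (Syr 1 x)"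

lemma DD_coprime:
  assumes "k \<in> DD"
  shows "odd k" "coprime k 3"
proof -
  have "k mod 6 = 1 \<or> k mod 6 = 5"
    using assms by (auto simp: DD_def cong_def)
  then have k: "k mod 2 = 1" "k mod 3 = 1 \<or> k mod 3 = 2"
    by presburger+
  show "odd k"
    using k(1) by presburger
  have "\<not> 3 dvd k"
    using k(2) by presburger
  moreover have "prime (3::int)"
    by simp
  ultimately show "coprime k 3"
    by (metis coprime_commute prime_imp_coprime)
qed

lemma three_x_plus_1_nonzero: "3 * x + 1 \<noteq> (0::int)"
  by presburger

lemma Syr_1_eq: "2 ^ multiplicity 2 (3 * x + 1) * Syr 1 x = 3 * x + 1"
  unfolding Syr_def by (intro dvd_mult_div_cancel multiplicity_dvd)

lemma Syr_1_odd: "odd (Syr 1 x)"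
proof
  let ?a = "multiplicity 2 (3 * x + 1)"
  assume "even (Syr 1 x)"
  then have "2 ^ ?a * 2 dvd 2 ^ ?a * Syr 1 x"
    by (rule mult_dvd_mono[OF dvd_refl])
  then have "2 ^ Suc ?a dvd 3 * x + 1"
    unfolding Syr_1_eq by (simp add: mult.commute)
  moreover have "\<not> 2 ^ Suc ?a dvd 3 * x + 1"
    using three_x_plus_1_nonzero by (subst power_dvd_iff_le_multiplicity) auto
  ultimately show False
    by blast
qed

text \<open>
  The congruence \<open>x = k * x'\<close> loses \<open>a\<close> factors 2 to the division and gains a factor 3 from
  the multiplication by 3. Since \<open>a \<le> L\<close>, the surviving even modulus forces both
  maps to divide by the same power of 2.
\<close>

lemma Syr_cong_step:
  fixes k x x' :: int
  defines "a \<equiv> multiplicity 2 (3 * x' + 1)"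
  assumes "odd k" and a: "a \<le> L"
    and cong: "2 ^ Suc L * 3 ^ j dvd x - k * x'"
  shows "2 ^ Suc (L - a) * 3 ^ Suc j dvd Syr k x - k * Syr 1 x'"
proof -
  have diff: "(3 * x + k) - 2 ^ a * (k * Syr 1 x') = 3 * (x - k * x')"
  proof -
    have "2 ^ a * (k * Syr 1 x') = k * (3 * x' + 1)"
      unfolding a_def by (metis Syr_1_eq mult.left_commute)
    then show ?thesis
      by (simp add: algebra_simps)
  qed
  from cong obtain c where c: "x - k * x' = 2 ^ Suc L * 3 ^ j * c" ..
  have pow: "(2::int) ^ Suc L = 2 ^ a * 2 ^ Suc (L - a)"
    using a by (simp flip: power_add)
  have x: "3 * x + k = 2 ^ a * (k * Syr 1 x' + 2 ^ Suc (L - a) * 3 ^ Suc j * c)"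
    using diff unfolding c pow by (simp add: algebra_simps)
  have odd: "odd (k * Syr 1 x' + 2 ^ Suc (L - a) * 3 ^ Suc j * c)"
    using \<open>odd k\<close> Syr_1_odd by simp
  have "multiplicity 2 (3 * x + k) = a"
    unfolding x using odd by (intro multiplicity_eqI) auto
  then have "Syr k x = k * Syr 1 x' + 2 ^ Suc (L - a) * 3 ^ Suc j * c"
    unfolding Syr_def x by simp
  then show ?thesis
    by simp
qed

text \<open>
  The exponent \<open>j\<close> carries the induction: it records the powers of 3 gained in the
  steps made so far. Starting without any, at \<open>j = 0\<close>, \<open>n\<close> steps gain \<open>3 ^ n\<close>.
\<close>

lemma Syr_funpow_cong:
  fixes k x x' :: int
  assumes "odd k" and "halvings n x' \<le> L"
    and "2 ^ Suc L * 3 ^ j dvd x - k * x'"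
  shows "[(Syr k ^^ n) x = k * (Syr 1 ^^ n) x'] (mod 3 ^ (n + j))"
  using assms(2,3)
proof (induction n arbitrary: x x' L j)
  case 0
  then show ?case
    by (auto simp: cong_iff_dvd_diff elim: dvd_mult_right)
next
  case (Suc n)
  let ?a = "multiplicity 2 (3 * x' + 1)"
  have "2 ^ Suc (L - ?a) * 3 ^ Suc j dvd Syr k x - k * Syr 1 x'"
    using Suc.prems by (intro Syr_cong_step \<open>odd k\<close>) auto
  moreover have "halvings n (Syr 1 x') \<le> L - ?a"
    using Suc.prems(1) by simp
  ultimately show ?case
    using Suc.IH[of "Syr 1 x'" "L - ?a" "Suc j" "Syr k x"]
    by (simp only: funpow_Suc_right o_apply add_Suc_right add_Suc)
qed

section \<open>Starting points with many halvings are rare\<close>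

text \<open>
  Split \<open>S\<close> by the exponent \<open>a\<close> of 2 removed in the first step. The points with \<open>a > L\<close>
  all solve \<open>3 * x + 1 = 0\<close> modulo \<open>2 ^ (L + 1)\<close>, so there is at most one. For
  \<open>1 \<le> a \<le> L\<close>, knowing the image modulo \<open>2 ^ (L + 1 - a)\<close> determines \<open>x\<close>
  modulo \<open>2 ^ (L + 1)\<close>, so the image again consists of incongruent points and the bound
  follows by induction from \<open>1 + L * L ^ n \<le> (L + 1) ^ (n + 1)\<close>.
\<close>

lemma card_many_halvings:
  assumes "finite S" and "\<And>x. x \<in> S \<Longrightarrow> odd x" and "\<And>x. x \<in> S \<Longrightarrow> L < halvings n x"
    and "\<And>x y. x \<in> S \<Longrightarrow> y \<in> S \<Longrightarrow> 2 ^ Suc L dvd x - y \<Longrightarrow> x = y"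
  shows "card S \<le> (L + 1) ^ n"
  using assms
proof (induction n arbitrary: S L)
  case 0
  then have "S = {}" by auto
  then show ?case by simp
next
  case (Suc n)
  define v where "v x = multiplicity 2 (3 * x + 1)" for x :: int
  define T where "T a = {x \<in> S. v x = a}" for a
  define U where "U = {x \<in> S. L < v x}"
  have cancel: "x = y"
    if "x \<in> S" "y \<in> S" "2 ^ Suc L dvd (3 * x + 1) - (3 * y + 1)" for x y
  proof -
    have "2 ^ Suc L dvd 3 * (x - y)"
      using that(3) by (simp add: algebra_simps)
    moreover have "coprime (2 ^ Suc L) (3::int)"
      by simp
    ultimately have "2 ^ Suc L dvd x - y"
      using coprime_dvd_mult_right_iff by blast
    then show ?thesis
      using Suc.prems(4) that by blast
  qed
  have "x = y" if "x \<in> U" "y \<in> U" for x y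
  proof (rule cancel)
    have "2 ^ Suc L dvd 3 * z + 1" if "z \<in> U" for z
      using that unfolding U_def v_def by (intro multiplicity_dvd') auto
    then show "2 ^ Suc L dvd (3 * x + 1) - (3 * y + 1)"
      using that by (intro dvd_diff)
  qed (use that in \<open>auto simp: U_def\<close>)
  then have card_U: "card U \<le> 1"
    using Suc.prems(1) by (subst card_le_Suc0_iff_eq[simplified One_nat_def[symmetric]]) (auto simp: U_def)
  have card_T: "card (T a) \<le> L ^ n" if a: "a \<in> {1..L}" for a
  proof -
    have eq: "x = y" if "x \<in> T a" "y \<in> T a" "2 ^ Suc (L - a) dvd Syr 1 x - Syr 1 y" for x y
    proof (rule cancel)
      have "2 ^ a * 2 ^ Suc (L - a) dvd 2 ^ a * (Syr 1 x - Syr 1 y)"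
        by (rule mult_dvd_mono) (use that in auto)
      moreover have "(2::int) ^ a * 2 ^ Suc (L - a) = 2 ^ Suc L"
        using a by (simp flip: power_add)
      moreover have "2 ^ a * (Syr 1 x - Syr 1 y) = (3 * x + 1) - (3 * y + 1)"
        using that Syr_1_eq[of x] Syr_1_eq[of y]
        by (simp add: T_def v_def right_diff_distrib)
      ultimately show "2 ^ Suc L dvd (3 * x + 1) - (3 * y + 1)"
        by (simp only:)
    qed (use that in \<open>auto simp: T_def\<close>)
    have "inj_on (Syr 1) (T a)"
      using eq by (auto intro: inj_onI)
    then have "card (T a) = card (Syr 1 ` T a)"
      by (simp add: card_image)
    also have "\<dots> \<le> (L - a + 1) ^ n"
    proof (rule Suc.IH)
      show "finite (Syr 1 ` T a)"
        using Suc.prems(1) by (simp add: T_def)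
      show "L - a < halvings n x" if "x \<in> Syr 1 ` T a" for x
        using that Suc.prems(3) a by (force simp: T_def v_def)
    qed (use eq Syr_1_odd in auto)
    also have "\<dots> \<le> L ^ n"
      using a by (intro power_mono) auto
    finally show ?thesis .
  qed
  have "S \<subseteq> U \<union> (\<Union>a\<in>{1..L}. T a)"
  proof
    fix x assume "x \<in> S"
    then have "even (3 * x + 1)"
      using Suc.prems(2) by simp
    then have "v x \<noteq> 0"
      unfolding v_def using three_x_plus_1_nonzero[of x] by (simp add: multiplicity_eq_zero_iff)
    with \<open>x \<in> S\<close> show "x \<in> U \<union> (\<Union>a\<in>{1..L}. T a)"
      by (auto simp: U_def T_def not_less)
  qed
  moreover have "finite (U \<union> (\<Union>a\<in>{1..L}. T a))"
    using Suc.prems(1) by (auto simp: U_def T_def)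
  ultimately have "card S \<le> card (U \<union> (\<Union>a\<in>{1..L}. T a))"
    by (intro card_mono)
  also have "\<dots> \<le> card U + card (\<Union>a\<in>{1..L}. T a)"
    by (rule card_Un_le)
  also have "card (\<Union>a\<in>{1..L}. T a) \<le> (\<Sum>a\<in>{1..L}. card (T a))"
    by (intro card_UN_le) simp
  also have "\<dots> \<le> (\<Sum>a\<in>{1..L}. L ^ n)"
    by (intro sum_mono card_T)
  also have "card U + (\<Sum>a\<in>{1..L}. L ^ n) \<le> 1 + L ^ Suc n"
    using card_U by simp
  also have "\<dots> \<le> (L + 1) * (L + 1) ^ n"
  proof -
    have "L * L ^ n \<le> L * (L + 1) ^ n"
      by (intro mult_left_mono power_mono) auto
    moreover have "1 \<le> (L + 1) ^ n"
      by simp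
    ultimately show ?thesis
      by (simp only: add_mult_distrib power_Suc mult_1)
  qed
  finally show ?case
    by simp
qed

section \<open>Averages of functions that are periodic up to few residues\<close>

lemma card_residue_class:
  fixes M r :: int and N :: nat
  assumes "M > 0" and "0 \<le> r" and "r < M"
  shows "\<bar>real (card {z \<in> {1..N}. int z mod M = r}) - real N / real_of_int M\<bar> \<le> 1"
proof -
  have step: "(a + 1) div M = a div M + of_bool (M dvd a + 1)" for a :: int
  proof (cases "a mod M + 1 = M")
    case True
    then have "a + 1 = M * (a div M + 1)"
      using mult_div_mod_eq[of M a] by (simp only: distrib_left)
    then show ?thesis
      using \<open>M > 0\<close> by simp
  next
    case False
    then have less: "a mod M + 1 < M" "0 \<le> a mod M"
      using \<open>M > 0\<close> pos_mod_bound[of M a] pos_mod_sign[of M a] by linarith+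
    have a: "a + 1 = M * (a div M) + (a mod M + 1)"
      by simp
    have "(a + 1) div M = a div M"
      by (rule int_div_pos_eq[OF a]) (use less in auto)
    moreover have "(a + 1) mod M = a mod M + 1"
      by (rule int_mod_pos_eq[OF a]) (use less in auto)
    ultimately show ?thesis
      using less by (auto simp: dvd_eq_mod_eq_0)
  qed
  have "int (card {z \<in> {1..N}. int z mod M = r}) = (int N - r) div M - (- r) div M"
  proof (induction N)
    case 0
    then show ?case by simp
  next
    case (Suc N)
    have "int (Suc N) mod M = r \<longleftrightarrow> M dvd int N - r + 1"
      using mod_eq_dvd_iff[of "int (Suc N)" M r] assms by (simp add: algebra_simps)
    moreover have "{z \<in> {1..Suc N}. int z mod M = r}
        = {z \<in> {1..N}. int z mod M = r} \<union> (if int (Suc N) mod M = r then {Suc N} else {})"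
      by (auto simp: le_Suc_eq)
    ultimately show ?case
      using Suc.IH step[of "int N - r"] by (simp add: algebra_simps)
  qed
  then have card: "real (card {z \<in> {1..N}. int z mod M = r})
      = \<lfloor>(real N - r) / M\<rfloor> - \<lfloor>- real_of_int r / M\<rfloor>"
    using floor_divide_of_int_eq[of "int N - r" M, where 'a=real]
      floor_divide_of_int_eq[of "- r" M, where 'a=real] by simp
  have "real N / M = (real N - r) / M - (- real_of_int r / M)"
    by (simp add: diff_divide_distrib)
  then show ?thesis
    unfolding card by linarith
qed

text \<open>
  Each residue class contains \<open>N / M\<close> points up to an error of 1, which costs \<open>M\<close> in total;
  a class in \<open>B\<close>, on which nothing is known about \<open>h\<close>, costs at most a further
  \<open>N / M\<close>. The permutation \<open>\<tau>\<close> is there so that the periodic model \<open>F\<close>, and with it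
  the main term, can be the same for different functions \<open>h\<close>.
\<close>

lemma sum_almost_periodic:
  fixes M :: int and N :: nat and h F :: "int \<Rightarrow> real"
  assumes "M > 0" and \<tau>: "bij_betw \<tau> {0..<M} {0..<M}"
    and "B \<subseteq> {0..<M}"
    and h: "\<And>z. h z \<in> {0..1}" and F: "\<And>r. F r \<in> {0..1}"
    and eq: "\<And>r z. r \<in> {0..<M} - B \<Longrightarrow> z mod M = \<tau> r \<Longrightarrow> h z = F r"
  shows "\<bar>(\<Sum>z = 1..N. h (int z)) - real N / M * (\<Sum>r\<in>{0..<M}. F r)\<bar>
    \<le> M + card B * (real N / M)"
proof -
  define C where "C r = {z \<in> {1..N}. int z mod M = \<tau> r}" for r
  have "(\<Sum>z = 1..N. h (int z)) = (\<Sum>r\<in>{0..<M}. \<Sum>z \<in> C r. h (int z))"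
  proof -
    have "(\<Sum>z = 1..N. h (int z)) = (\<Sum>s\<in>{0..<M}. \<Sum>z \<in> {z \<in> {1..N}. int z mod M = s}. h (int z))"
      using \<open>M > 0\<close> by (intro sum.group[symmetric]) auto
    also have "\<dots> = (\<Sum>r\<in>{0..<M}. \<Sum>z \<in> C r. h (int z))"
      unfolding C_def by (rule sum.reindex_bij_betw[OF \<tau>, symmetric])
    finally show ?thesis .
  qed
  then have "\<bar>(\<Sum>z = 1..N. h (int z)) - real N / M * (\<Sum>r\<in>{0..<M}. F r)\<bar>
    = \<bar>\<Sum>r\<in>{0..<M}. (\<Sum>z \<in> C r. h (int z)) - real N / M * F r\<bar>"
    by (simp add: sum_subtractf sum_distrib_left)
  also have "\<dots> \<le> (\<Sum>r\<in>{0..<M}. \<bar>(\<Sum>z \<in> C r. h (int z)) - real N / M * F r\<bar>)"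
    by (rule sum_abs)
  also have "\<dots> \<le> (\<Sum>r\<in>{0..<M}. 1 + (if r \<in> B then real N / M else 0))"
  proof (rule sum_mono)
    fix r assume r: "r \<in> {0..<M}"
    then have "\<tau> r \<in> {0..<M}"
      using \<tau> bij_betwE by blast
    then have card: "\<bar>card (C r) - real N / M\<bar> \<le> 1"
      unfolding C_def using \<open>M > 0\<close> by (intro card_residue_class) auto
    show "\<bar>(\<Sum>z \<in> C r. h (int z)) - real N / M * F r\<bar> \<le> 1 + (if r \<in> B then real N / M else 0)"
    proof (cases "r \<in> B")
      case True
      have "0 \<le> (\<Sum>z \<in> C r. h (int z))"
        using h by (intro sum_nonneg) auto
      moreover have "(\<Sum>z \<in> C r. h (int z)) \<le> (\<Sum>z \<in> C r. 1)"
        using h by (intro sum_mono) auto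
      moreover have "0 \<le> real N / M * F r" "real N / M * F r \<le> real N / M"
        using F[of r] mult_left_le[of "F r" "real N / M"] \<open>M > 0\<close> by auto
      ultimately show ?thesis
        using card True by auto
    next
      case False
      have "(\<Sum>z \<in> C r. h (int z)) = (\<Sum>z \<in> C r. F r)"
        using False r by (intro sum.cong refl eq) (auto simp: C_def)
      then have "(\<Sum>z \<in> C r. h (int z)) - real N / M * F r = (card (C r) - real N / M) * F r"
        by (simp add: left_diff_distrib)
      then have "\<bar>(\<Sum>z \<in> C r. h (int z)) - real N / M * F r\<bar> = \<bar>card (C r) - real N / M\<bar> * F r"
        using F[of r] by (simp only: abs_mult) simp
      also have "\<dots> \<le> 1 * 1"
        using card F[of r] by (intro mult_mono) auto
      finally show ?thesis
        using False by simp
    qed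
  qed
  also have "\<dots> = M + card B * (real N / M)"
    using \<open>B \<subseteq> _\<close> \<open>M > 0\<close> by (simp add: sum.distrib sum.If_cases Int_absorb1)
  finally show ?thesis .
qed

lemma bij_betw_affine_mod:
  fixes k c M :: int
  assumes "M > 0" and "coprime k M"
  shows "bij_betw (\<lambda>r. (k * r + c) mod M) {0..<M} {0..<M}"
proof -
  have "inj_on (\<lambda>r. (k * r + c) mod M) {0..<M}"
  proof (rule inj_onI)
    fix r s assume rs: "r \<in> {0..<M}" "s \<in> {0..<M}"
      and "(k * r + c) mod M = (k * s + c) mod M"
    then have "[k * r + c = k * s + c] (mod M)"
      by (simp add: cong_def)
    then have "[r = s] (mod M)"
      using \<open>coprime k M\<close> by (simp add: cong_add_rcancel cong_mult_lcancel)
    then show "r = s"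
      using rs by (simp add: cong_def)
  qed
  moreover have "(\<lambda>r. (k * r + c) mod M) ` {0..<M} \<subseteq> {0..<M}"
    using \<open>M > 0\<close> by auto
  ultimately show ?thesis
    by (simp add: bij_betw_def endo_inj_surj)
qed

section \<open>The scaling law\<close>

text \<open>
  As \<open>lim\<close> is a definite description of the limit, it is determined by which numbers are
  limits of the sequence, and these are the same for \<open>X\<close> and \<open>Y\<close>.
\<close>

lemma lim_eq_if_diff_tendsto_0:
  fixes X Y :: "nat \<Rightarrow> real"
  assumes "(\<lambda>N. X N - Y N) \<longlonglongrightarrow> 0"
  shows "lim X = lim Y"
proof -
  have "X \<longlonglongrightarrow> l \<longleftrightarrow> Y \<longlonglongrightarrow> l" for l
    using Lim_transform[OF _ assms] Lim_transform2[OF _ assms] by blast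
  then show ?thesis
    unfolding lim_def by simp
qed

text \<open>
  Both sums are compared with the same main term, a sum over the residues \<open>r\<close> of
  \<open>z\<close> modulo \<open>2 ^ L\<close> for \<open>Syr 1\<close>. Applying this to the parameter 1 as well is not
  circular: it expresses that \<open>Syr 1 ^^ n\<close> is periodic modulo \<open>3 ^ n\<close> off the bad
  residues.
\<close>

lemma sum_Syr_diff_le:
  fixes k y :: int and n L N :: nat
  assumes "k \<in> DD"
  shows "\<bar>(\<Sum>z = 1..N. of_bool ([(Syr k ^^ n) (2 * int z + 1) = k * y] (mod 3 ^ n)))
      - (\<Sum>z = 1..N. of_bool ([(Syr 1 ^^ n) (2 * int z + 1) = y] (mod 3 ^ n)))\<bar>
    \<le> 2 * (2 ^ L + real ((L + 1) ^ n) * (real N / 2 ^ L))"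
proof -
  define f where "f k y z = (of_bool ([(Syr k ^^ n) (2 * z + 1) = y] (mod 3 ^ n)) :: real)"
    for k y z :: int
  define M :: int where "M = 2 ^ L"
  define B where "B = {r \<in> {0..<M}. L < halvings n (2 * r + 1)}"
  have "M > 0"
    by (simp add: M_def)
  have "finite B"
    by (rule finite_subset[of _ "{0..<M}"]) (auto simp: B_def)
  have "card B = card ((\<lambda>r. 2 * r + 1) ` B)"
    by (intro card_image[symmetric] inj_onI) simp
  also have "\<dots> \<le> (L + 1) ^ n"
  proof (rule card_many_halvings)
    fix x y assume "x \<in> (\<lambda>r. 2 * r + 1) ` B" "y \<in> (\<lambda>r. 2 * r + 1) ` B" "2 ^ Suc L dvd x - y"
    then obtain r s where rs: "r \<in> B" "s \<in> B" "x = 2 * r + 1" "y = 2 * s + 1"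
      and "2 * M dvd 2 * (r - s)"
      by (auto simp: M_def)
    then have "[r = s] (mod M)"
      unfolding cong_iff_dvd_diff by (subst (asm) dvd_mult_cancel_left) simp
    with rs show "x = y"
      by (simp add: B_def cong_def)
  qed (use \<open>finite B\<close> in simp, auto simp: B_def)
  finally have card_B: "card B \<le> (L + 1) ^ n" .
  have approx: "\<bar>(\<Sum>z = 1..N. f k (k * y) (int z)) - real N / M * (\<Sum>r\<in>{0..<M}. f 1 y r)\<bar>
      \<le> M + card B * (real N / M)" if "k \<in> DD" for k
  proof (rule sum_almost_periodic)
    note k = DD_coprime[OF that]
    \<comment> \<open>the map \<open>x \<mapsto> k * x\<close> on odd numbers, in the coordinate \<open>r\<close> with \<open>x = 2 * r + 1\<close>\<close>
    show "bij_betw (\<lambda>r. (k * r + (k - 1) div 2) mod M) {0..<M} {0..<M}"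
      using k \<open>M > 0\<close> by (intro bij_betw_affine_mod) (auto simp: M_def)
    show "f k (k * y) z = f 1 y r"
      if r: "r \<in> {0..<M} - B" and z: "z mod M = (k * r + (k - 1) div 2) mod M" for r z
    proof -
      have halvings: "halvings n (2 * r + 1) \<le> L"
        using r by (auto simp: B_def)
      have "M dvd z - (k * r + (k - 1) div 2)"
        using z by (simp add: mod_eq_dvd_iff)
      then have "2 * M dvd 2 * (z - (k * r + (k - 1) div 2))"
        by (rule mult_dvd_mono[OF dvd_refl])
      also have "2 * (z - (k * r + (k - 1) div 2)) = (2 * z + 1) - k * (2 * r + 1)"
        using k(1) by (auto elim!: oddE simp: algebra_simps)
      finally have "[(Syr k ^^ n) (2 * z + 1) = k * (Syr 1 ^^ n) (2 * r + 1)] (mod 3 ^ n)"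
        using Syr_funpow_cong[OF k(1) halvings, of 0 "2 * z + 1"]
        by (simp only: M_def power_Suc power_0 mult_1_right add_0_right)
      moreover have "[k * (Syr 1 ^^ n) (2 * r + 1) = k * y] (mod 3 ^ n)
          \<longleftrightarrow> [(Syr 1 ^^ n) (2 * r + 1) = y] (mod 3 ^ n)"
        using k(2) by (intro cong_mult_lcancel) simp
      ultimately show ?thesis
        unfolding f_def by (simp add: cong_def)
    qed
  qed (auto simp: \<open>M > 0\<close> B_def f_def)
  have "1 \<in> DD"
    by (simp add: DD_def)
  have "\<bar>(\<Sum>z = 1..N. f k (k * y) (int z)) - (\<Sum>z = 1..N. f 1 y (int z))\<bar>
      \<le> 2 * (M + card B * (real N / M))"
  proof -
    have triangle: "\<bar>a - b\<bar> \<le> 2 * d" if "\<bar>a - c\<bar> \<le> d" "\<bar>b - c\<bar> \<le> d" for a b c d :: real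
      using that by linarith
    show ?thesis
      by (rule triangle[OF approx[OF assms] approx[OF \<open>1 \<in> DD\<close>, unfolded mult_1_left]])
  qed
  also have "\<dots> \<le> 2 * (M + real ((L + 1) ^ n) * (real N / M))"
    using card_B \<open>M > 0\<close> by (intro mult_left_mono add_left_mono mult_right_mono of_nat_mono) auto
  finally show ?thesis
    by (simp add: f_def M_def)
qed

lemma P_scale:
  assumes "k \<in> DD"
  shows "P k n (k * y) = P 1 n y"
  unfolding P_def
proof (rule lim_eq_if_diff_tendsto_0)
  define D where "D N = (\<Sum>z = 1..N. of_bool ([(Syr k ^^ n) (2 * int z + 1) = k * y] (mod 3 ^ n)))
      - (\<Sum>z = 1..N. of_bool ([(Syr 1 ^^ n) (2 * int z + 1) = y] (mod 3 ^ n)) :: real)" for N :: nat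
  have "(\<lambda>N. 1 / real N * D N) \<longlonglongrightarrow> 0"
  proof (rule LIMSEQ_I)
    fix e :: real assume "e > 0"
    have "(\<lambda>L. 2 * (real ((L + 1) ^ n) / 2 ^ L)) \<longlonglongrightarrow> 0"
      by real_asymp
    \<comment> \<open>\<open>L\<close> makes the bad residues rare, and \<open>N\<close> then absorbs the constant \<open>2 * 2 ^ L\<close>\<close>
    then obtain L where L: "2 * (real ((L + 1) ^ n) / 2 ^ L) < e / 2"
      using \<open>e > 0\<close> by (metis (no_types, lifting) half_gt_zero eventually_happens order_tendstoD(2) sequentially_bot)
    show "\<exists>N0. \<forall>N\<ge>N0. norm (1 / real N * D N - 0) < e"
    proof (intro exI allI impI)
      fix N assume "nat \<lceil>4 * 2 ^ L / e\<rceil> + 1 \<le> N"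
      then have N: "4 * 2 ^ L / e < real N"
        by linarith
      then have "real N > 0"
        using \<open>e > 0\<close> by (smt (verit) divide_pos_pos zero_less_power)
      have "\<bar>D N\<bar> \<le> 2 * (2 ^ L + real ((L + 1) ^ n) * (real N / 2 ^ L))"
        unfolding D_def by (rule sum_Syr_diff_le[OF assms])
      also have "\<dots> = 2 * 2 ^ L + 2 * (real ((L + 1) ^ n) / 2 ^ L) * real N"
        by (simp add: distrib_left)
      also have "\<dots> < e / 2 * real N + e / 2 * real N"
        using N L \<open>e > 0\<close> \<open>real N > 0\<close>
        by (intro add_strict_mono mult_strict_right_mono) (auto simp: field_simps)
      finally show "norm (1 / real N * D N - 0) < e"
        using \<open>real N > 0\<close> by (simp add: abs_mult field_simps)
    qed
  qed
  then show "(\<lambda>N. 1 / real N * (\<Sum>z = 1..N. of_bool ([(Syr k ^^ n) (2 * int z + 1) = k * y] (mod 3 ^ n)))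
      - 1 / real N * (\<Sum>z = 1..N. of_bool ([(Syr 1 ^^ n) (2 * int z + 1) = y] (mod 3 ^ n)))) \<longlonglongrightarrow> 0"
    by (simp only: D_def right_diff_distrib)
qed

lemma P_cong:
  assumes "[y = y'] (mod 3 ^ n)"
  shows "P k n y = P k n y'"
proof -
  have "[x = y] (mod 3 ^ n) \<longleftrightarrow> [x = y'] (mod 3 ^ n)" for x
    using assms cong_trans cong_sym by blast
  then show ?thesis
    unfolding P_def by simp
qed

theorem mainTheorem2:
  fixes m n :: nat and k :: int
  assumes "m \<le> n" and "k \<in> DD"
  shows "Osc k m n = Osc 1 m n"
proof -
  define osc where "osc k Y = \<bar>P k n Y - 3 powi (int m - int n) * P k m (Y mod 3 ^ m)\<bar>" for k Y
  have "bij_betw (\<lambda>Y. (k * Y + 0) mod 3 ^ n) {0..<3 ^ n} {0..<3 ^ n}"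
    using DD_coprime[OF \<open>k \<in> DD\<close>] by (intro bij_betw_affine_mod) auto
  then have "(\<Sum>Y \<in> {0..<3 ^ n}. osc k Y) = (\<Sum>Y \<in> {0..<3 ^ n}. osc k ((k * Y + 0) mod 3 ^ n))"
    by (rule sum.reindex_bij_betw[symmetric])
  also have "\<dots> = (\<Sum>Y \<in> {0..<3 ^ n}. osc 1 Y)"
  proof (rule sum.cong)
    fix Y :: int
    have "P k n ((k * Y + 0) mod 3 ^ n) = P 1 n Y"
      unfolding P_scale[OF \<open>k \<in> DD\<close>, symmetric] by (rule P_cong) simp
    moreover have "P k m ((k * Y + 0) mod 3 ^ n mod 3 ^ m) = P 1 m (Y mod 3 ^ m)"
      unfolding P_scale[OF \<open>k \<in> DD\<close>, symmetric]
      using \<open>m \<le> n\<close> by (intro P_cong) (simp add: cong_def mod_mod_cancel le_imp_power_dvd mod_mult_right_eq)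
    ultimately show "osc k ((k * Y + 0) mod 3 ^ n) = osc 1 Y"
      by (simp only: osc_def)
  qed simp
  finally show ?thesis
    by (simp add: Osc_def osc_def)
qed

end
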